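(* If $f:\mathbb{N}\to\mathbb{C}$ is completely multiplicative, then, as formal Dirichlet series, $$\widetilde{D}(f,s)=\exp\left(\sum_p\frac{f(p)}{p^s}\right),$$ where the sum is over all primes $p$.
   Context: $f$ is completely multiplicative if $f(1)=1$ and $f(mn)=f(m)f(n)$ for all $m,n$. For $n\in\mathbb{N}$ write $n=\prod_p p^{\nu_p(n)}$ and $\xi(n)=\prod_p\nu_p(n)!$. The exponential Dirichlet series of $f$ is the formal Dirichlet series $\widetilde{D}(f,s)=\sum_{n=1}^\infty\frac{f(n)}{\xi(n)n^s}$. $\exp(t)=\sum_{k\ge0}t^k/k!$ is the formal exponential series, applied to a formal Dirichlet series with zero coefficient at $n=1$ (using the Dirichlet product of formal Dirichlet series). *)

theory Defs
  imports Complex_Main "HOL-Computational_Algebra.Primes"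
begin

text \<open>
  A formal Dirichlet series is its coefficient sequence indexed by the positive integers;
  the irrelevant value at 0 is normalised to 0 so that equality of series is equality of
  all coefficients at \<open>n \<ge> 1\<close>.
\<close>

typedef (overloaded) 'a fds = "{a :: nat \<Rightarrow> 'a::zero. a 0 = 0}"
  morphisms fds_nth Abs_fds
  by (rule exI[of _ "\<lambda>_. 0"]) simp

setup_lifting type_definition_fds

lift_definition fds :: "(nat \<Rightarrow> 'a) \<Rightarrow> 'a::zero fds"
  is "\<lambda>a n. if n = 0 then 0 else a n" by simp

lemma fds_nth_0 [simp]: "fds_nth F 0 = 0"
  by transfer simp

lemma fds_nth_fds: "fds_nth (fds a) n = (if n = 0 then 0 else a n)"
  by transfer simp

lemma fds_eqI: "(\<And>n. n > 0 \<Longrightarrow> fds_nth F n = fds_nth G n) \<Longrightarrow> F = G"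
  by transfer (metis ext gr0I)

instantiation fds :: (comm_ring_1) comm_ring_1
begin

lift_definition zero_fds :: "'a fds" is "\<lambda>_. 0" by simp

lift_definition one_fds :: "'a fds" is "\<lambda>n. if n = 1 then 1 else 0" by simp

lift_definition plus_fds :: "'a fds \<Rightarrow> 'a fds \<Rightarrow> 'a fds" is "\<lambda>a b n. a n + b n" by simp

lift_definition minus_fds :: "'a fds \<Rightarrow> 'a fds \<Rightarrow> 'a fds" is "\<lambda>a b n. a n - b n" by simp

lift_definition uminus_fds :: "'a fds \<Rightarrow> 'a fds" is "\<lambda>a n. - a n" by simp

definition times_fds :: "'a fds \<Rightarrow> 'a fds \<Rightarrow> 'a fds" where
  "F * G = fds (\<lambda>n. \<Sum>d | d dvd n. fds_nth F d * fds_nth G (n div d))"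

lemma fds_nth_times_pairs:
  assumes "n > 0"
  shows "fds_nth (F * G :: 'a fds) n = (\<Sum>(d, e) | d * e = n. fds_nth F d * fds_nth G e)"
proof -
  have "(\<Sum>(d, e) | d * e = n. fds_nth F d * fds_nth G e) =
        (\<Sum>d | d dvd n. fds_nth F d * fds_nth G (n div d))"
    using assms
    by (intro sum.reindex_bij_witness[of _ "\<lambda>d. (d, n div d)" fst]) auto
  then show ?thesis
    using assms by (simp add: times_fds_def fds_nth_fds)
qed

lemma finite_factor_pairs:
  assumes "n > (0::nat)"
  shows "finite {(d, e). d * e = n}"
proof (rule finite_subset)
  show "{(d, e). d * e = n} \<subseteq> {..n} \<times> {..n}"
    using assms by (auto intro: dvd_imp_le)
qed simp

instance
proof
  fix F G H :: "'a fds"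
  show "F * G = G * F"
  proof (rule fds_eqI)
    fix n :: nat assume n: "n > 0"
    show "fds_nth (F * G) n = fds_nth (G * F) n"
      unfolding fds_nth_times_pairs[OF n]
      by (intro sum.reindex_bij_witness[of _ prod.swap prod.swap]) (auto simp: mult_ac)
  qed
  show "F * G * H = F * (G * H)"
  proof (rule fds_eqI)
    fix n :: nat assume n: "n > 0"
    define P where "P m = {(d, e). d * e = (m::nat)}" for m
    have fin: "finite (P m)" if "m > 0" for m
      unfolding P_def using finite_factor_pairs[OF that] .
    have pos: "fst x > 0 \<and> snd x > 0" if "x \<in> P n" for x
      using that n by (auto simp: P_def intro: Nat.gr0I)
    have "fds_nth (F * G * H) n =
      (\<Sum>x\<in>P n. \<Sum>y\<in>P (fst x). fds_nth F (fst y) * fds_nth G (snd y) * fds_nth H (snd x))"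
      unfolding fds_nth_times_pairs[OF n]
      using n
      by (intro sum.cong)
        (auto simp: P_def case_prod_unfold sum_distrib_right fds_nth_times_pairs)
    also have "\<dots> = (\<Sum>z\<in>Sigma (P n) (\<lambda>x. P (fst x)).
        fds_nth F (fst (snd z)) * fds_nth G (snd (snd z)) * fds_nth H (snd (fst z)))"
      using n pos fin by (subst sum.Sigma) (auto simp: case_prod_unfold)
    also have "\<dots> = (\<Sum>z\<in>Sigma (P n) (\<lambda>x. P (snd x)).
        fds_nth F (fst (fst z)) * (fds_nth G (fst (snd z)) * fds_nth H (snd (snd z))))"
      by (rule sum.reindex_bij_witness[of _
            "\<lambda>((a, m), (b, c)). ((a * b, c), (a, b))" "\<lambda>((m, c), (a, b)). ((a, b * c), (b, c))"])
        (auto simp: P_def mult_ac)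
    also have "\<dots> =
      (\<Sum>x\<in>P n. \<Sum>y\<in>P (snd x). fds_nth F (fst x) * (fds_nth G (fst y) * fds_nth H (snd y)))"
      using n pos fin by (subst sum.Sigma) (auto simp: case_prod_unfold)
    also have "\<dots> = fds_nth (F * (G * H)) n"
      unfolding fds_nth_times_pairs[OF n]
      using n
      by (intro sum.cong)
        (auto simp: P_def case_prod_unfold sum_distrib_left fds_nth_times_pairs)
    finally show "fds_nth (F * G * H) n = fds_nth (F * (G * H)) n" .
  qed
  show "1 * F = F"
  proof (rule fds_eqI)
    fix n :: nat assume n: "n > 0"
    have "fds_nth (1 * F) n = (\<Sum>d | d dvd n. if d = 1 then fds_nth F n else 0)"
      unfolding times_fds_def fds_nth_fds if_not_P[OF n[unfolded neq0_conv[symmetric]]]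
      by (intro sum.cong) (auto simp: one_fds.rep_eq)
    also have "\<dots> = fds_nth F n"
      using n by (subst sum.delta) auto
    finally show "fds_nth (1 * F) n = fds_nth F n" .
  qed
  show "(F + G) * H = F * H + G * H"
    by (rule fds_eqI)
      (simp add: times_fds_def fds_nth_fds plus_fds.rep_eq distrib_right sum.distrib)
  show "F + G + H = F + (G + H)" by transfer (simp add: add_ac)
  show "F + G = G + F" by transfer (simp add: add_ac)
  show "0 + F = F" by transfer simp
  show "- F + F = 0" by transfer simp
  show "F - G = F + - G" by transfer simp
  show "(0 :: 'a fds) \<noteq> 1" by transfer (metis zero_neq_one)
qed

end

lemma fds_nth_mult:
  "n > 0 \<Longrightarrow> fds_nth (F * G) n = (\<Sum>d | d dvd n. fds_nth F d * fds_nth G (n div d))"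
  by (simp add: times_fds_def fds_nth_fds)

text \<open>The series \<open>c / m\<^sup>s\<close>.\<close>

definition fds_term :: "'a \<Rightarrow> nat \<Rightarrow> 'a::zero fds" where
  "fds_term c m = fds (\<lambda>n. if n = m then c else 0)"

text \<open>
  Infinite sums of formal series are taken coefficientwise: for each \<open>n \<ge> 1\<close> only finitely many
  summands may have a nonzero coefficient at \<open>n\<close>, and these coefficients are added up. No
  analytic convergence is involved; the value of the sum is meaningful only under this local
  finiteness, which the lemmas below establish for the two sums that are used.
\<close>

definition fds_Sum :: "'i set \<Rightarrow> ('i \<Rightarrow> 'a fds) \<Rightarrow> 'a::comm_monoid_add fds" where
  "fds_Sum I F = fds (\<lambda>n. \<Sum>i | i \<in> I \<and> fds_nth (F i) n \<noteq> 0. fds_nth (F i) n)"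

text \<open>
  The exponential is meant for \<open>F\<close> with zero coefficient at 1; \<open>fds_term c 1\<close> is the
  constant series \<open>c\<close>, and powers are with respect to Dirichlet convolution.
\<close>

definition fds_exp :: "'a::field_char_0 fds \<Rightarrow> 'a fds" where
  "fds_exp F = fds_Sum UNIV (\<lambda>k::nat. fds_term (1 / fact k) 1 * F ^ k)"

definition prime_fds :: "(nat \<Rightarrow> 'a) \<Rightarrow> 'a::comm_monoid_add fds" where
  "prime_fds f = fds_Sum {p. prime p} (\<lambda>p. fds_term (f p) p)"

definition xi :: "nat \<Rightarrow> nat" where
  "xi n = (\<Prod>p\<in>prime_factors n. fact (multiplicity p n))"

definition exp_dirichlet_series :: "(nat \<Rightarrow> 'a) \<Rightarrow> 'a::field_char_0 fds" where
  "exp_dirichlet_series f = fds (\<lambda>n. f n / of_nat (xi n))"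

text \<open>Arithmetic functions live on the positive integers, so the value at 0 is unconstrained.\<close>

definition completely_multiplicative :: "(nat \<Rightarrow> 'a::comm_semiring_1) \<Rightarrow> bool" where
  "completely_multiplicative f \<longleftrightarrow>
     f 1 = 1 \<and> (\<forall>m n. m > 0 \<longrightarrow> n > 0 \<longrightarrow> f (m * n) = f m * f n)"

lemma fds_nth_term_1_mult:
  "fds_nth (fds_term c 1 * F) n = c * fds_nth (F :: 'a::comm_ring_1 fds) n"
proof (cases "n = 0")
  case False
  have "fds_nth (fds_term c 1 * F) n = (\<Sum>d | d dvd n. if d = 1 then c * fds_nth F n else 0)"
    using False
    by (simp only: fds_nth_mult neq0_conv, intro sum.cong) (auto simp: fds_term_def fds_nth_fds)
  also have "\<dots> = c * fds_nth F n"
    using False by (subst sum.delta) auto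
  finally show ?thesis .
qed simp

lemma fds_nth_power_eq_0:
  fixes F :: "'a::comm_ring_1 fds"
  assumes "fds_nth F 1 = 0" and "n < 2 ^ k"
  shows "fds_nth (F ^ k) n = 0"
  using assms(2)
proof (induction k arbitrary: n)
  case (Suc k)
  show ?case
  proof (cases "n = 0")
    case False
    have "fds_nth F d * fds_nth (F ^ k) (n div d) = 0" if "d dvd n" for d
    proof (cases "d = 1")
      case False
      with that \<open>n \<noteq> 0\<close> have "d \<ge> 2"
        by (cases d) (auto simp: Suc_le_eq)
      then have "n div d \<le> n div 2" by (simp add: div_le_mono2)
      also have "\<dots> < 2 ^ k" using Suc.prems by auto
      finally show ?thesis using Suc.IH by simp
    qed (use assms(1) in simp)
    with False show ?thesis by (simp add: fds_nth_mult)
  qed simp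
qed simp

lemma finite_fds_exp_support:
  fixes F :: "'a::field_char_0 fds"
  assumes "fds_nth F 1 = 0"
  shows "finite {k. fds_nth (fds_term (1 / fact k) 1 * F ^ k) n \<noteq> 0}"
proof (rule finite_subset)
  show "{k. fds_nth (fds_term (1 / fact k) 1 * F ^ k) n \<noteq> 0} \<subseteq> {..n}"
  proof
    fix k assume "k \<in> {k. fds_nth (fds_term (1 / fact k) 1 * F ^ k) n \<noteq> 0}"
    then have "fds_nth (F ^ k) n \<noteq> 0" by (auto simp: fds_nth_term_1_mult simp del: One_nat_def)
    then have "2 ^ k \<le> n" using fds_nth_power_eq_0[OF assms] by (meson not_le)
    then show "k \<in> {..n}" using le_trans[OF less_imp_le[OF less_exp[of k]]] by simp
  qed
qed simp

lemma finite_prime_fds_support: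
  "finite {p. p \<in> {p. prime p} \<and> fds_nth (fds_term (f p) p) n \<noteq> 0}"
  by (rule finite_subset[of _ "{n}"]) (auto simp: fds_term_def fds_nth_fds split: if_splits)

lemma fds_nth_prime_fds: "fds_nth (prime_fds f) n = (if prime n then f n else 0)"
proof -
  have "{p. p \<in> {p. prime p} \<and> fds_nth (fds_term (f p) p) n \<noteq> 0} =
      (if prime n \<and> f n \<noteq> 0 then {n} else {})"
    by (auto simp: fds_term_def fds_nth_fds prime_gt_0_nat split: if_splits)
  then show ?thesis
    by (auto simp: prime_fds_def fds_Sum_def fds_nth_fds fds_term_def)
qed

end

theory Submission imports Defs begin

text \<open>
  Write \<open>P\<close> for the sum of \<open>f p / p\<^sup>s\<close> over the primes, and \<open>\<Omega> n\<close> for the number of prime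
  factors of \<open>n\<close> with multiplicity. The coefficient of \<open>P ^ k\<close> at \<open>n\<close> counts, with weight \<open>f n\<close>,
  the orderings of the prime factors of \<open>n\<close>: it is \<open>k! f n / \<xi> n\<close> if \<open>\<Omega> n = k\<close>, and \<open>0\<close> otherwise.
  This follows by induction on \<open>k\<close> from \<open>\<xi> n = \<nu>\<^sub>p n \<cdot> \<xi> (n / p)\<close> and \<open>\<Sum>\<^sub>p \<nu>\<^sub>p n = \<Omega> n\<close>.
  Hence exactly one term of the exponential series contributes at each \<open>n\<close>.
\<close>

text \<open>Passing from \<open>m\<close> to \<open>p * m\<close> raises only the exponent of
  \<open>p\<close>, by one, so a single factorial in the product changes.\<close>

lemma xi_prime_mult:
  assumes "prime p" "m > 0"
  shows "xi (p * m) = multiplicity p (p * m) * xi m"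
proof -
  let ?A = "insert p (prime_factors m)"
  have A: "prime_factors (p * m) = ?A"
    using assms by (auto simp: prime_factors_product prime_prime_factors)
  have other: "multiplicity q (p * m) = multiplicity q m" if "q \<in> ?A - {p}" for q
    using that assms
    by (auto simp: prime_elem_multiplicity_mult_distrib prime_multiplicity_other
        dest!: in_prime_factors_imp_prime)
  have self: "multiplicity p (p * m) = Suc (multiplicity p m)"
    using assms by (simp add: prime_elem_multiplicity_mult_distrib)
  \<comment> \<open>If \<open>p\<close> does not divide \<open>m\<close>, the added factor is
    \<open>fact 0 = 1\<close>.\<close>
  have "xi m = (\<Prod>q\<in>?A. fact (multiplicity q m))"
    unfolding xi_def using assms not_dvd_imp_multiplicity_0[of p m]
    by (intro prod.mono_neutral_left) (force simp: prime_factors_dvd)+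
  also have "\<dots> = fact (multiplicity p m) * (\<Prod>q\<in>?A - {p}. fact (multiplicity q m))"
    by (rule prod.remove) auto
  finally have "xi m = fact (multiplicity p m) * (\<Prod>q\<in>?A - {p}. fact (multiplicity q m))" .
  moreover have "xi (p * m) =
      fact (multiplicity p (p * m)) * (\<Prod>q\<in>?A - {p}. fact (multiplicity q (p * m)))"
    unfolding xi_def A by (rule prod.remove) auto
  ultimately show ?thesis
    using other by (simp add: self distrib_right)
qed

lemma sum_multiplicity_prime_factors:
  "(\<Sum>p\<in>prime_factors n. multiplicity p n) = size (prime_factorization n)" for n :: nat
  unfolding size_multiset_overloaded_eq
  by (intro sum.cong) (auto simp: count_prime_factorization_prime dest: in_prime_factors_imp_prime)

lemma fds_nth_prime_fds_power:
  fixes f :: "nat \<Rightarrow> 'a::field_char_0"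
  assumes "completely_multiplicative f" and "n > 0"
  shows "fds_nth (prime_fds f ^ k) n =
    (if size (prime_factorization n) = k then fact k * f n / of_nat (xi n) else 0)"
  using assms(2)
proof (induction k arbitrary: n)
  case 0
  have "prime_factorization n = {#} \<longleftrightarrow> n = 1"
    using 0 by (simp add: prime_factorization_empty_iff)
  then show ?case
    using assms(1) by (auto simp: one_fds.rep_eq xi_def completely_multiplicative_def)
next
  case (Suc k)
  \<comment> \<open>Free of \<open>p\<close>, so it leaves the sum over primes; the remaining factor
    is \<open>Suc k\<close> whenever \<open>?c\<close> is nonzero, turning \<open>fact k\<close>
    into \<open>fact (Suc k)\<close>.\<close>
  let ?c = "if size (prime_factorization n) = Suc k then fact k * f n / of_nat (xi n) else 0"
  have summand: "fds_nth (prime_fds f) p * fds_nth (prime_fds f ^ k) (n div p) =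
      of_nat (multiplicity p n) * ?c" if p: "p \<in> prime_factors n" for p
  proof -
    from p obtain m where n: "n = p * m" and "prime p"
      by (meson dvdE in_prime_factors_imp_dvd in_prime_factors_imp_prime)
    with Suc.prems have m: "m > 0" and p0: "p > 0" by auto
    have size: "size (prime_factorization n) = Suc (size (prime_factorization m))"
      using m \<open>prime p\<close> by (simp add: n prime_factorization_mult prime_factorization_prime)
    have "f n = f p * f m"
      using assms(1) m p0 by (simp add: n completely_multiplicative_def)
    \<comment> \<open>Nonzero also in characteristic 0, so it cancels against the same factor of
      \<open>xi n\<close>.\<close>
    moreover have "multiplicity p n > 0"
      using p by (simp add: prime_factors_multiplicity)
    moreover have "xi n = multiplicity p n * xi m"
      using xi_prime_mult[OF \<open>prime p\<close> m] by (simp add: n)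
    moreover have "n div p = m"
      using p0 by (simp add: n)
    ultimately show ?thesis
      using Suc.IH[OF m] \<open>prime p\<close> size by (simp add: fds_nth_prime_fds)
  qed
  have "fds_nth (prime_fds f ^ Suc k) n =
      (\<Sum>d | d dvd n. fds_nth (prime_fds f) d * fds_nth (prime_fds f ^ k) (n div d))"
    using Suc.prems by (simp add: fds_nth_mult)
  also have "\<dots> = (\<Sum>p\<in>prime_factors n.
      fds_nth (prime_fds f) p * fds_nth (prime_fds f ^ k) (n div p))"
    using Suc.prems
    by (intro sum.mono_neutral_right) (auto simp: prime_factors_dvd fds_nth_prime_fds)
  also have "\<dots> = (\<Sum>p\<in>prime_factors n. of_nat (multiplicity p n) * ?c)"
    using summand by (rule sum.cong[OF refl])
  also have "\<dots> = of_nat (size (prime_factorization n)) * ?c"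
    by (simp flip: sum_distrib_right sum_multiplicity_prime_factors)
  finally show ?case
    by simp
qed

theorem theorem5p2:
  fixes f :: "nat \<Rightarrow> complex"
  assumes "completely_multiplicative f"
  shows "exp_dirichlet_series f = fds_exp (prime_fds f)"
proof (rule fds_eqI)
  fix n :: nat assume n: "n > 0"
  let ?N = "size (prime_factorization n)"
  have coeff: "fds_nth (fds_term (1 / fact k) 1 * prime_fds f ^ k) n =
      (if k = ?N then f n / of_nat (xi n) else 0)" for k
    by (auto simp: fds_nth_term_1_mult fds_nth_prime_fds_power[OF assms n] simp del: One_nat_def)
  \<comment> \<open>\<open>fds_Sum\<close> keeps only indices with a nonzero coefficient, so for
    \<open>f n = 0\<close> the index set is empty instead of \<open>{?N}\<close>.\<close>
  have "fds_nth (fds_exp (prime_fds f)) n =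
      (\<Sum>k | k = ?N \<and> f n / of_nat (xi n) \<noteq> 0. f n / of_nat (xi n))"
    unfolding fds_exp_def fds_Sum_def fds_nth_fds coeff
    using n by (auto intro!: sum.cong)
  also have "\<dots> = f n / of_nat (xi n)"
    by (cases "f n / of_nat (xi n) = 0") auto
  finally show "fds_nth (exp_dirichlet_series f) n = fds_nth (fds_exp (prime_fds f)) n"
    using n by (simp add: exp_dirichlet_series_def fds_nth_fds)
qed

end
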